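(* There exists a ring $R$ with a full and unboundedly free $\mathbb Z$-grading such that $R_0$ has UGN and $R$ has BGN.
   Context: Rings are unital; "module" means right module unless stated otherwise. A ring $S$ has unbounded generating number (UGN) if, for every positive integer $n$, there is no $S$-module epimorphism $S^n\to S^{n+1}$; otherwise $S$ has bounded generating number (BGN). $S^0$ denotes the zero module. A $\mathbb Z$-grading on $R$ is a family of additive subgroups $R_k$ ($k\in\mathbb Z$) with $R=\bigoplus_{k\in\mathbb Z}R_k$ as additive groups and $R_kR_l\subseteq R_{k+l}$ for all $k,l\in\mathbb Z$; $R_0$ is the base ring. The grading is full if $R_k\neq0$ for all $k$. It is free if either all the $R_k$ are finitely generated free right $R_0$-modules, or all the $R_k$ are finitely generated free left $R_0$-modules. It is boundedly free if there is a positive integer $r$ such that either for each $k$ there is an integer $i\in[0,r]$ with $R_k\cong(R_0)^i$ as right $R_0$-modules, or for each $k$ there is an integer $i\in[0,r]$ with $R_k\cong (R_0)^i$ as left $R_0$-modules. It is unboundedly free if it is free but not boundedly free. *)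

theory Defs
  imports "HOL-Algebra.AbelCoset" "HOL-Algebra.Module"
begin

section \<open>One-sided modules over a noncommutative ring\<close>

text \<open>
  The locale \<^locale>\<open>module\<close> requires a commutative base ring, so only its record type is used
  here. The fields \<^const>\<open>mult\<close> and \<^const>\<open>one\<close> that this record inherits from rings play no
  role and are left undefined. In a right module, \<open>s \<odot>\<^bsub>M\<^esub> m\<close> stands for the
  product \<open>m s\<close>, so that linearity of a map reads the same for left and right modules.
\<close>

definition module_hom ::
  "('s, 'r) ring_scheme \<Rightarrow> ('s, 'm, 'a) module_scheme \<Rightarrow> ('s, 'n, 'b) module_scheme \<Rightarrow> ('m \<Rightarrow> 'n) set"
  where "module_hom S M N =
    {f \<in> carrier M \<rightarrow> carrier N.
      (\<forall>x\<in>carrier M. \<forall>y\<in>carrier M. f (x \<oplus>\<^bsub>M\<^esub> y) = f x \<oplus>\<^bsub>N\<^esub> f y) \<and>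
      (\<forall>s\<in>carrier S. \<forall>x\<in>carrier M. f (s \<odot>\<^bsub>M\<^esub> x) = s \<odot>\<^bsub>N\<^esub> f x)}"

definition module_epi ::
  "('s, 'r) ring_scheme \<Rightarrow> ('s, 'm, 'a) module_scheme \<Rightarrow> ('s, 'n, 'b) module_scheme \<Rightarrow> ('m \<Rightarrow> 'n) set"
  where "module_epi S M N = {f \<in> module_hom S M N. f ` carrier M = carrier N}"

definition module_isomorphic ::
  "('s, 'r) ring_scheme \<Rightarrow> ('s, 'm, 'a) module_scheme \<Rightarrow> ('s, 'n, 'b) module_scheme \<Rightarrow> bool"
  where "module_isomorphic S M N \<longleftrightarrow>
    (\<exists>f \<in> module_hom S M N. bij_betw f (carrier M) (carrier N))"

text \<open>
  The modules \<open>S\<^sup>n\<close>: \<open>n\<close>-tuples are extensional functions on \<open>{..<n}\<close>, so for \<open>n = 0\<close> the carrier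
  has exactly one element and this is the zero module.
\<close>

definition right_power :: "('s, 'r) ring_scheme \<Rightarrow> nat \<Rightarrow> ('s, nat \<Rightarrow> 's) module"
  where "right_power S n =
    \<lparr> carrier = {..<n} \<rightarrow>\<^sub>E carrier S, mult = undefined, one = undefined,
      zero = (\<lambda>i\<in>{..<n}. \<zero>\<^bsub>S\<^esub>),
      add = (\<lambda>x y. \<lambda>i\<in>{..<n}. x i \<oplus>\<^bsub>S\<^esub> y i),
      smult = (\<lambda>s x. \<lambda>i\<in>{..<n}. x i \<otimes>\<^bsub>S\<^esub> s) \<rparr>"

definition left_power :: "('s, 'r) ring_scheme \<Rightarrow> nat \<Rightarrow> ('s, nat \<Rightarrow> 's) module"
  where "left_power S n =
    \<lparr> carrier = {..<n} \<rightarrow>\<^sub>E carrier S, mult = undefined, one = undefined,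
      zero = (\<lambda>i\<in>{..<n}. \<zero>\<^bsub>S\<^esub>),
      add = (\<lambda>x y. \<lambda>i\<in>{..<n}. x i \<oplus>\<^bsub>S\<^esub> y i),
      smult = (\<lambda>s x. \<lambda>i\<in>{..<n}. s \<otimes>\<^bsub>S\<^esub> x i) \<rparr>"


section \<open>Unbounded and bounded generating number\<close>

definition UGN :: "('s, 'r) ring_scheme \<Rightarrow> bool"
  where "UGN S \<longleftrightarrow>
    (\<forall>n>0. \<not> (\<exists>f. f \<in> module_epi S (right_power S n) (right_power S (n + 1))))"

definition BGN :: "('s, 'r) ring_scheme \<Rightarrow> bool"
  where "BGN S \<longleftrightarrow> \<not> UGN S"


section \<open>Rings graded by the integers\<close>

text \<open>
  The last axiom expresses that \<open>R\<close> is the internal direct sum of the subgroups \<open>G k\<close>: every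
  element has exactly one decomposition into components, almost all of which vanish.
\<close>

locale Z_graded_ring = ring R for R (structure) +
  fixes G :: "int \<Rightarrow> 'a set"
  assumes component_subgroup: "additive_subgroup (G k) R"
    and component_mult: "\<lbrakk> x \<in> G k; y \<in> G l \<rbrakk> \<Longrightarrow> x \<otimes> y \<in> G (k + l)"
    and direct_sum: "x \<in> carrier R \<Longrightarrow>
      \<exists>!c. (\<forall>k. c k \<in> G k) \<and> finite {k. c k \<noteq> \<zero>} \<and> x = (\<Oplus>k\<in>{k. c k \<noteq> \<zero>}. c k)"

definition base_ring :: "('a, 'r) ring_scheme \<Rightarrow> (int \<Rightarrow> 'a set) \<Rightarrow> ('a, 'r) ring_scheme"
  where "base_ring R G = R\<lparr>carrier := G 0\<rparr>"

text \<open>The component \<open>G k\<close> as a right, respectively left, module over the base ring.\<close>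

definition right_component :: "('a, 'r) ring_scheme \<Rightarrow> (int \<Rightarrow> 'a set) \<Rightarrow> int \<Rightarrow> ('a, 'a) module"
  where "right_component R G k =
    \<lparr> carrier = G k, mult = undefined, one = undefined,
      zero = \<zero>\<^bsub>R\<^esub>, add = add R, smult = (\<lambda>s x. x \<otimes>\<^bsub>R\<^esub> s) \<rparr>"

definition left_component :: "('a, 'r) ring_scheme \<Rightarrow> (int \<Rightarrow> 'a set) \<Rightarrow> int \<Rightarrow> ('a, 'a) module"
  where "left_component R G k =
    \<lparr> carrier = G k, mult = undefined, one = undefined,
      zero = \<zero>\<^bsub>R\<^esub>, add = add R, smult = (\<lambda>s x. s \<otimes>\<^bsub>R\<^esub> x) \<rparr>"

definition right_component_iso :: "('a, 'r) ring_scheme \<Rightarrow> (int \<Rightarrow> 'a set) \<Rightarrow> int \<Rightarrow> nat \<Rightarrow> bool"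
  where "right_component_iso R G k i \<longleftrightarrow>
    module_isomorphic (base_ring R G) (right_component R G k) (right_power (base_ring R G) i)"

definition left_component_iso :: "('a, 'r) ring_scheme \<Rightarrow> (int \<Rightarrow> 'a set) \<Rightarrow> int \<Rightarrow> nat \<Rightarrow> bool"
  where "left_component_iso R G k i \<longleftrightarrow>
    module_isomorphic (base_ring R G) (left_component R G k) (left_power (base_ring R G) i)"

definition full_grading :: "('a, 'r) ring_scheme \<Rightarrow> (int \<Rightarrow> 'a set) \<Rightarrow> bool"
  where "full_grading R G \<longleftrightarrow> (\<forall>k. G k \<noteq> {\<zero>\<^bsub>R\<^esub>})"

definition free_grading :: "('a, 'r) ring_scheme \<Rightarrow> (int \<Rightarrow> 'a set) \<Rightarrow> bool"
  where "free_grading R G \<longleftrightarrow>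
    (\<forall>k. \<exists>i. right_component_iso R G k i) \<or> (\<forall>k. \<exists>i. left_component_iso R G k i)"

definition boundedly_free_grading :: "('a, 'r) ring_scheme \<Rightarrow> (int \<Rightarrow> 'a set) \<Rightarrow> bool"
  where "boundedly_free_grading R G \<longleftrightarrow>
    (\<exists>r>0. (\<forall>k. \<exists>i\<in>{0..r}. right_component_iso R G k i) \<or>
           (\<forall>k. \<exists>i\<in>{0..r}. left_component_iso R G k i))"

definition unboundedly_free_grading :: "('a, 'r) ring_scheme \<Rightarrow> (int \<Rightarrow> 'a set) \<Rightarrow> bool"
  where "unboundedly_free_grading R G \<longleftrightarrow> free_grading R G \<and> \<not> boundedly_free_grading R G"

end

theory Submission
  imports Defs "HOL-Library.Numeral_Type" "HOL-Library.Countable"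
begin

text \<open>
  Let \<open>R\<close> be the algebra over the field with two elements with generators \<open>x\<^sub>i\<close> of degree
  \<open>1\<close> and \<open>y\<^sub>i\<close> of degree \<open>-1\<close>, for \<open>i\<close> in a set of three letters, and relations
  \<open>x\<^sub>i y\<^sub>k + y\<^sub>i x\<^sub>k = \<delta>\<^sub>i\<^sub>k\<close>. The following three observations give the theorem.

  \<^bold>\<open>\<open>R\<close> has BGN.\<close> The relations say that the \<open>3 \<times> 2\<close> matrix with rows \<open>(x\<^sub>i, y\<^sub>i)\<close> times
  the \<open>2 \<times> 3\<close> matrix with columns \<open>(y\<^sub>k, x\<^sub>k)\<close> is the identity, so left multiplication by
  the former maps \<open>R\<^sup>2\<close> onto \<open>R\<^sup>3\<close> (\<open>BGN_total\<close>).

  \<^bold>\<open>The components are free.\<close> Read as the rewriting rule \<open>y\<^sub>i x\<^sub>k \<rightarrow> \<delta>\<^sub>i\<^sub>k - x\<^sub>i y\<^sub>k\<close>, the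
  relations have no overlaps, so the monomials \<open>x\<^sub>I y\<^sub>J\<close> with words \<open>I\<close>, \<open>J\<close> form a basis of
  \<open>R\<close>. Hence for \<open>n \<ge> 0\<close> the component \<open>R\<^sub>n\<close> is a free right \<open>R\<^sub>0\<close>-module on the \<open>3\<^sup>n\<close>
  monomials \<open>x\<^sub>I\<close> with \<open>|I| = n\<close>. The relations are invariant under
  exchanging the \<open>x\<^sub>i\<close> with the \<open>y\<^sub>i\<close>; this gives an automorphism that maps \<open>R\<^sub>n\<close> onto
  \<open>R\<^sub>-\<^sub>n\<close>, which is therefore free of rank \<open>3\<^sup>n\<close> as well (\<open>right_component_iso_enc\<close>).

  \<^bold>\<open>\<open>R\<^sub>0\<close> has UGN, and ranks over \<open>R\<^sub>0\<close> are bounded below.\<close> Rewriting never removes a leading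
  \<open>x\<close> or a trailing \<open>y\<close>. So the monomials other than \<open>1\<close> span an ideal of \<open>R\<^sub>0\<close>, and the
  coefficient of \<open>1\<close> is a ring homomorphism from \<open>R\<^sub>0\<close> to the field with two elements. An
  epimorphism \<open>R\<^sub>0\<^sup>n \<rightarrow> R\<^sub>0\<^sup>n\<^sup>+\<^sup>1\<close> would induce a surjection of a set with \<open>2\<^sup>n\<close> elements onto
  one with \<open>2\<^sup>n\<^sup>+\<^sup>1\<close> elements (\<open>UGN_base\<close>). The same count, applied to the
  coefficients of the monomials \<open>x\<^sub>I\<close> for right modules and \<open>y\<^sub>J\<close> for left modules, shows that a basis of
  \<open>R\<^sub>n\<close>, respectively of \<open>R\<^sub>-\<^sub>n\<close>, with \<open>i\<close> elements satisfies \<open>3\<^sup>n \<le> 2\<^sup>i\<close>, so the ranks are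
  unbounded on both sides (\<open>not_boundedly_free\<close>).
\<close>

section \<open>The underlying vector space\<close>

text \<open>
  The algebra \<open>R\<close> over the set of letters \<open>'l\<close>. An element is the set of those pairs \<open>(I, J)\<close>
  for which the monomial \<open>x\<^sub>I y\<^sub>J\<close> has coefficient \<open>1\<close>; addition modulo two is symmetric
  difference.
\<close>

typedef 'l alg = "{A :: ('l list \<times> 'l list) set. finite A}"
  morphisms supp Abs_alg by blast

setup_lifting type_definition_alg

instantiation alg :: (type) ab_group_add
begin

lift_definition zero_alg :: "'a alg" is "{}" by simp
lift_definition plus_alg :: "'a alg \<Rightarrow> 'a alg \<Rightarrow> 'a alg" is "\<lambda>A B. (A - B) \<union> (B - A)" by simp
lift_definition minus_alg :: "'a alg \<Rightarrow> 'a alg \<Rightarrow> 'a alg" is "\<lambda>A B. (A - B) \<union> (B - A)" by simp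
lift_definition uminus_alg :: "'a alg \<Rightarrow> 'a alg" is "\<lambda>A. A" .

instance by standard (transfer; blast)+

end

lemma finite_supp [simp]: "finite (supp v)"
  using supp[of v] by simp

lemma supp_add: "w \<in> supp (u + v) \<longleftrightarrow> (w \<in> supp u) \<noteq> (w \<in> supp v)"
  by transfer auto

lemma supp_zero [simp]: "supp 0 = {}"
  by transfer simp

lemma alg_eqI: "(\<And>I J. (I, J) \<in> supp u \<longleftrightarrow> (I, J) \<in> supp v) \<Longrightarrow> u = v"
  by transfer auto

lemma add_self [simp]: "u + u = (0 :: 'l alg)"
  by (rule alg_eqI) (simp add: supp_add)

text \<open>The monomial \<open>x\<^sub>I y\<^sub>J\<close>.\<close>

lift_definition basis :: "'l list \<Rightarrow> 'l list \<Rightarrow> 'l alg" is "\<lambda>I J. {(I, J)}" by simp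

lemma supp_basis [simp]: "supp (basis I J) = {(I, J)}"
  by transfer simp

lemma supp_sum_basis:
  assumes "finite A" shows "supp (\<Sum>(I, J)\<in>A. basis I J) = A"
  using assms
proof (induction A)
  case (insert w A)
  obtain I J where w: "w = (I, J)" by (cases w)
  show ?case
    using insert.hyps by (subst sum.insert) (auto simp: w set_eq_iff supp_add insert.IH)
qed simp

lemma alg_decomp: "v = (\<Sum>(I, J)\<in>supp v. basis I J)"
  using supp_sum_basis[OF finite_supp, of v] by (metis supp_inject)

text \<open>
  Additive statements need only be checked on monomials, and only on those that occur in \<open>v\<close>.
\<close>

lemma alg_induct [case_names zero basis add]:
  assumes "P 0"
    and "\<And>I J. (I, J) \<in> supp v \<Longrightarrow> P (basis I J)"
    and "\<And>u w. P u \<Longrightarrow> P w \<Longrightarrow> P (u + w)"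
  shows "P v"
proof -
  have "P (\<Sum>(I, J)\<in>A. basis I J)" if "finite A" "A \<subseteq> supp v" for A
    using that by (induction A) (auto intro!: assms)
  then show ?thesis
    using alg_decomp[of v] by (metis finite_supp order_refl)
qed

text \<open>
  The linear extension of a map on monomials. Over the field with two elements it is the sum over
  the support.
\<close>

definition lin :: "('l list \<Rightarrow> 'l list \<Rightarrow> 'l alg) \<Rightarrow> 'l alg \<Rightarrow> 'l alg" where
  "lin g v = (\<Sum>(I, J)\<in>supp v. g I J)"

lemma lin_zero [simp]: "lin g 0 = 0"
  by (simp add: lin_def)

lemma lin_basis [simp]: "lin g (basis I J) = g I J"
  by (simp add: lin_def)

lemma lin_add [simp]: "lin g (u + v) = lin g u + lin g v"
proof -
  let ?g = "\<lambda>(I, J). g I J"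
  let ?A = "supp u" and ?B = "supp v"
  have "supp (u + v) = (?A - ?B) \<union> (?B - ?A)"
    by (auto simp: supp_add)
  then have "lin g (u + v) = sum ?g (?A - ?B) + sum ?g (?B - ?A)"
    unfolding lin_def by (simp only:) (subst sum.union_disjoint; auto)
  moreover have "sum ?g ?A = sum ?g (?A - ?B) + sum ?g (?A \<inter> ?B)"
    by (subst sum.union_disjoint[symmetric]) (auto intro: sum.cong)
  moreover have "sum ?g ?B = sum ?g (?B - ?A) + sum ?g (?A \<inter> ?B)"
    by (subst sum.union_disjoint[symmetric]) (auto intro: sum.cong)
  ultimately show ?thesis
    by (simp add: lin_def ac_simps)
qed

section \<open>The multiplication\<close>

text \<open>
  The operators by which \<open>x\<^sub>i\<close> and \<open>y\<^sub>i\<close> act from the left. The action \<open>y_basis\<close> of \<open>y\<^sub>i\<close>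
  on a monomial carries \<open>y\<^sub>i\<close> to the right by the rule
  \<open>y\<^sub>i x\<^sub>k \<rightarrow> \<delta>\<^sub>i\<^sub>k + x\<^sub>i y\<^sub>k\<close> until it passes all letters \<open>x\<close>; the sign is irrelevant in
  characteristic two.
\<close>

definition shift_x :: "'l \<Rightarrow> 'l alg \<Rightarrow> 'l alg" where
  "shift_x i = lin (\<lambda>I J. basis (i # I) J)"

fun y_basis :: "'l \<Rightarrow> 'l list \<Rightarrow> 'l list \<Rightarrow> 'l alg" where
  "y_basis i [] J = basis [] (i # J)"
| "y_basis i (k # I) J = (if i = k then basis I J else 0) + shift_x i (y_basis k I J)"

definition shift_y :: "'l \<Rightarrow> 'l alg \<Rightarrow> 'l alg" where
  "shift_y i = lin (y_basis i)"

text \<open>The operator by which the monomial \<open>x\<^sub>I y\<^sub>J\<close> acts.\<close>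

definition act :: "'l list \<Rightarrow> 'l list \<Rightarrow> 'l alg \<Rightarrow> 'l alg" where
  "act I J v = foldr shift_x I (foldr shift_y J v)"

lemma shift_add [simp]:
  "shift_x i (u + v) = shift_x i u + shift_x i v"
  "shift_y i (u + v) = shift_y i u + shift_y i v"
  by (simp_all add: shift_x_def shift_y_def)

lemma shift_zero [simp]: "shift_x i 0 = 0" "shift_y i 0 = 0"
  by (simp_all add: shift_x_def shift_y_def)

lemma shift_basis [simp]:
  "shift_x i (basis I J) = basis (i # I) J"
  "shift_y i (basis I J) = y_basis i I J"
  by (simp_all add: shift_x_def shift_y_def)

text \<open>
  The operators satisfy the defining relations.
\<close>

lemma shift_y_shift_x:
  "shift_y i (shift_x k v) = (if i = k then v else 0) + shift_x i (shift_y k v)"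
  by (induction v rule: alg_induct) (auto simp: ac_simps)

lemma foldr_shift_add:
  "foldr shift_x I (u + v) = foldr shift_x I u + foldr shift_x I v"
  "foldr shift_y I (u + v) = foldr shift_y I u + foldr shift_y I v"
  by (induction I) auto

lemma act_add [simp]: "act I J (u + v) = act I J u + act I J v"
  by (simp_all add: act_def foldr_shift_add)

lemma act_one: "act I J (basis [] []) = basis I J"
proof -
  have "foldr shift_y J (basis [] []) = basis [] J"
    by (induction J) auto
  moreover have "foldr shift_x I (basis [] J) = basis I J"
    by (induction I) auto
  ultimately show ?thesis by (simp add: act_def)
qed

text \<open>
  Replacing each monomial of the left factor by its operator defines the multiplication.
  Associativity amounts to \<open>act\<close> being multiplicative, which is checked on the generators
  (\<open>shift_x_times\<close>, \<open>shift_y_times\<close>); this is where the relations enter.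
\<close>

instantiation alg :: (type) ring_1
begin

definition times_alg :: "'a alg \<Rightarrow> 'a alg \<Rightarrow> 'a alg" where
  "u * v = lin (\<lambda>I J. act I J v) u"

definition one_alg :: "'a alg" where
  "1 = basis [] []"

lemma basis_times: "basis I J * v = act I J v"
  and zero_times: "0 * v = (0 :: 'a alg)"
  and add_times: "(u + u') * v = u * v + u' * (v :: 'a alg)"
  by (simp_all add: times_alg_def)

lemma times_add: "u * (v + v') = u * v + u * (v' :: 'a alg)"
  by (induction u rule: alg_induct) (simp_all add: zero_times basis_times add_times ac_simps)

lemma shift_x_times: "shift_x i u * v = shift_x i (u * v)"
  by (induction u rule: alg_induct) (simp_all add: zero_times basis_times add_times act_def)

lemma shift_y_times: "shift_y i u * v = shift_y i (u * v)"
proof (induction u rule: alg_induct)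
  case (basis I J)
  show ?case
  proof (induction I arbitrary: i)
    case (Cons k I)
    have "y_basis i (k # I) J * v
        = (if i = k then basis I J * v else 0) + shift_x i (y_basis k I J * v)"
      by (simp add: add_times zero_times shift_x_times)
    also have "\<dots> = (if i = k then basis I J * v else 0) + shift_x i (shift_y k (basis I J * v))"
      using Cons[of k] by simp
    also have "\<dots> = shift_y i (basis (k # I) J * v)"
      by (simp add: basis_times act_def shift_y_shift_x)
    finally show ?case by simp
  qed (simp add: basis_times act_def)
qed (simp_all add: zero_times add_times)

lemma act_times: "act I J u * v = act I J (u * v)"
proof -
  have "foldr shift_y J u * v = foldr shift_y J (u * v)"
    by (induction J) (simp_all add: shift_y_times)
  moreover have "foldr shift_x I w * v = foldr shift_x I (w * v)" for w
    by (induction I) (simp_all add: shift_x_times)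
  ultimately show ?thesis by (simp add: act_def)
qed

instance
proof
  fix a b c :: "'a alg"
  show "a * b * c = a * (b * c)"
    by (induction a rule: alg_induct) (simp_all add: zero_times add_times basis_times act_times)
  show "(a + b) * c = a * c + b * c" by (rule add_times)
  show "a * (b + c) = a * b + a * c" by (rule times_add)
  show "1 * a = a" by (simp add: one_alg_def basis_times act_def)
  show "a * 1 = a"
    by (induction a rule: alg_induct)
      (simp_all add: zero_times add_times basis_times one_alg_def act_one)
  show "0 \<noteq> (1 :: 'a alg)"
    unfolding one_alg_def by (metis insert_not_empty supp_basis supp_zero)
qed

end

text \<open>The generators \<open>x\<^sub>i\<close> and \<open>y\<^sub>i\<close>.\<close>

definition x_gen :: "'l \<Rightarrow> 'l alg" where "x_gen i = basis [i] []"
definition y_gen :: "'l \<Rightarrow> 'l alg" where "y_gen i = basis [] [i]"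

lemma x_gen_times: "x_gen i * v = shift_x i v"
  and y_gen_times: "y_gen i * v = shift_y i v"
  by (simp_all add: x_gen_def y_gen_def basis_times act_def)

lemma y_gen_x_gen: "y_gen i * (x_gen k * v) = (if i = k then v else 0) + x_gen i * (y_gen k * v)"
  by (simp add: x_gen_times y_gen_times shift_y_shift_x)

lemma generator_relation: "x_gen i * (y_gen k * v) + y_gen i * (x_gen k * v) = (if i = k then v else 0)"
  by (simp add: y_gen_x_gen ac_simps)

lemma basis_Cons: "basis (i # I) J = x_gen i * basis I J"
  and basis_Nil_Cons: "basis [] (i # J) = y_gen i * basis [] J"
  by (simp_all add: x_gen_times y_gen_times)

lemma basis_Nil_Nil [simp]: "basis [] [] = 1"
  by (simp add: one_alg_def)

lemma supp_one [simp]: "supp 1 = {([], [])}"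
  by (simp flip: basis_Nil_Nil del: basis_Nil_Nil)

lemma basis_eq_times: "basis I J = basis I [] * basis [] J"
  by (induction I) (simp_all add: basis_Cons mult.assoc)

lemma basis_x_append: "basis (I @ I') J = basis I [] * basis I' J"
  by (induction I) (simp_all add: basis_Cons mult.assoc)

section \<open>The grading\<close>

text \<open>Every \<open>x\<^sub>i\<close> has degree \<open>1\<close> and every \<open>y\<^sub>i\<close> has degree \<open>-1\<close>.\<close>

definition deg :: "'l list \<times> 'l list \<Rightarrow> int" where
  "deg w = int (length (fst w)) - int (length (snd w))"

text \<open>The homogeneous component \<open>R\<^sub>k\<close>.\<close>

definition grade :: "int \<Rightarrow> 'l alg set" where
  "grade k = {v. \<forall>w\<in>supp v. deg w = k}"

lemma grade_zero [simp]: "0 \<in> grade k"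
  by (simp add: grade_def)

lemma grade_add: "u \<in> grade k \<Longrightarrow> v \<in> grade k \<Longrightarrow> u + v \<in> grade k"
  by (auto simp: grade_def supp_add)

lemma grade_sum: "(\<And>a. a \<in> A \<Longrightarrow> f a \<in> grade k) \<Longrightarrow> sum f A \<in> grade k"
  by (induction A rule: infinite_finite_induct) (auto intro: grade_add)

lemma basis_in_grade [simp]: "basis I J \<in> grade k \<longleftrightarrow> int (length I) - int (length J) = k"
  by (simp add: grade_def deg_def)

lemma one_in_grade [simp]: "1 \<in> grade 0"
  by (simp flip: basis_Nil_Nil del: basis_Nil_Nil)

lemma grade_basis: "v \<in> grade k \<Longrightarrow> (I, J) \<in> supp v \<Longrightarrow> int (length I) - int (length J) = k"
  by (auto simp: grade_def deg_def)

lemma shift_x_grade: assumes "v \<in> grade k" shows "shift_x i v \<in> grade (k + 1)"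
  by (induction v rule: alg_induct) (auto intro: grade_add dest: grade_basis[OF assms])

lemma y_basis_grade: "y_basis i I J \<in> grade (int (length I) - int (length J) - 1)"
proof (induction I arbitrary: i)
  case (Cons k I)
  have "shift_x i (y_basis k I J) \<in> grade (int (length I) - int (length J) - 1 + 1)"
    by (rule shift_x_grade[OF Cons])
  then show ?case by (auto intro!: grade_add)
qed simp

lemma shift_y_grade: assumes "v \<in> grade k" shows "shift_y i v \<in> grade (k - 1)"
proof (induction v rule: alg_induct)
  case (basis I J)
  then show ?case using y_basis_grade[of i I J] grade_basis[OF assms basis] by simp
qed (auto intro: grade_add)

lemma grade_times:
  assumes "u \<in> grade k" "v \<in> grade l"
  shows "u * v \<in> grade (k + l)"
proof (induction u rule: alg_induct)
  case (basis I J)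
  have "foldr shift_y J v \<in> grade (l - int (length J))"
    using assms(2) by (induction J) (auto dest: shift_y_grade simp: algebra_simps)
  then have "foldr shift_x I (foldr shift_y J v) \<in> grade (l - int (length J) + int (length I))"
    by (induction I) (auto dest: shift_x_grade simp: algebra_simps)
  then show ?case
    using grade_basis[OF assms(1) basis] by (simp add: basis_times act_def algebra_simps)
qed (auto simp: distrib_right intro: grade_add)

text \<open>The projection onto \<open>R\<^sub>k\<close>.\<close>

lift_definition component :: "int \<Rightarrow> 'l alg \<Rightarrow> 'l alg" is "\<lambda>k A. {w \<in> A. deg w = k}" by simp

lemma supp_component: "w \<in> supp (component k v) \<longleftrightarrow> w \<in> supp v \<and> deg w = k"
  by transfer simp

lemma component_in_grade [simp]: "component k v \<in> grade k"
  by (simp add: grade_def supp_component)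

lemma component_zero [simp]: "component k 0 = 0"
  by (rule alg_eqI) (simp add: supp_component)

lemma component_add: "component k (u + v) = component k u + component k v"
  by (rule alg_eqI) (auto simp: supp_component supp_add)

lemma component_sum: "component k (sum f A) = (\<Sum>a\<in>A. component k (f a))"
  by (induction A rule: infinite_finite_induct) (simp_all add: component_add)

lemma component_of_grade: "v \<in> grade l \<Longrightarrow> component k v = (if k = l then v else 0)"
  by (rule alg_eqI) (auto simp: supp_component grade_def)

lemma component_nonzero: "{k. component k v \<noteq> 0} = deg ` supp v"
proof -
  have "component k v \<noteq> 0 \<longleftrightarrow> (\<exists>w. w \<in> supp (component k v))" for k
    by (metis alg_eqI emptyE supp_zero)
  then show ?thesis by (auto simp: supp_component)
qed

lemma sum_component: "(\<Sum>k\<in>{k. component k v \<noteq> 0}. component k v) = v"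
proof -
  have "w \<in> supp (\<Sum>k\<in>K. component k v) \<longleftrightarrow> w \<in> supp v \<and> deg w \<in> K" if "finite K" for K w
    using that by (induction K) (auto simp: supp_add supp_component)
  from this[of "{k. component k v \<noteq> 0}"] show ?thesis
    by (intro alg_eqI) (auto simp: component_nonzero)
qed

section \<open>The symmetry exchanging the two families of generators\<close>

text \<open>
  The automorphism with \<open>x\<^sub>i \<mapsto> y\<^sub>i\<close> and \<open>y\<^sub>i \<mapsto> x\<^sub>i\<close>, defined as the linear map
  \<open>x\<^sub>I y\<^sub>J \<mapsto> y\<^sub>I x\<^sub>J\<close>.
\<close>

definition swap :: "'l alg \<Rightarrow> 'l alg" where
  "swap = lin (\<lambda>I J. basis [] I * basis J [])"

lemma swap_zero [simp]: "swap 0 = 0"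
  and swap_add [simp]: "swap (u + v) = swap u + swap v"
  and swap_basis: "swap (basis I J) = basis [] I * basis J []"
  by (simp_all add: swap_def)

lemma swap_x_gen_times: "swap (x_gen i * v) = y_gen i * swap v"
proof (induction v rule: alg_induct)
  case (basis I J)
  show ?case
    by (simp add: swap_basis basis_Nil_Cons mult.assoc flip: basis_Cons)
qed (simp_all add: distrib_left)

lemma swap_y_gen_times: "swap (y_gen i * v) = x_gen i * swap v"
proof (induction v rule: alg_induct)
  case (basis I J)
  show ?case
  proof (induction I arbitrary: i)
    case Nil
    show ?case
      by (simp add: swap_basis basis_Cons flip: basis_Nil_Cons)
  next
    case (Cons k I)
    have "swap (y_gen i * basis (k # I) J)
        = swap ((if i = k then basis I J else 0) + x_gen i * (y_gen k * basis I J))"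
      by (simp only: basis_Cons y_gen_x_gen)
    also have "\<dots> = (if i = k then swap (basis I J) else 0) + y_gen i * (x_gen k * swap (basis I J))"
      by (simp add: swap_x_gen_times Cons)
    also have "\<dots> = x_gen i * (y_gen k * swap (basis I J))"
      by (simp add: y_gen_x_gen)
    also have "\<dots> = x_gen i * swap (basis (k # I) J)"
      by (simp only: basis_Cons swap_x_gen_times)
    finally show ?case .
  qed
qed (simp_all add: distrib_left)

lemma swap_times: "swap (u * v) = swap u * swap v"
proof (induction u rule: alg_induct)
  case (basis I J)
  have y: "swap (basis [] J * v) = basis J [] * swap v"
    by (induction J) (simp_all add: basis_Nil_Cons basis_Cons mult.assoc swap_y_gen_times)
  have "swap (basis I [] * w) = basis [] I * swap w" for w
    by (induction I) (simp_all add: basis_Nil_Cons basis_Cons mult.assoc swap_x_gen_times)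
  moreover have "basis I J * v = basis I [] * (basis [] J * v)"
    by (metis basis_eq_times mult.assoc)
  ultimately show ?case
    by (simp add: swap_basis y mult.assoc)
qed (simp_all add: distrib_right)

lemma swap_swap [simp]: "swap (swap v) = v"
  by (induction v rule: alg_induct) (simp_all add: swap_basis swap_times flip: basis_eq_times)

lemma swap_grade: assumes "v \<in> grade k" shows "swap v \<in> grade (- k)"
proof (induction v rule: alg_induct)
  case (basis I J)
  have "basis [] I * basis J [] \<in> grade (- int (length I) + int (length J))"
    by (rule grade_times) simp_all
  then show ?case
    using grade_basis[OF assms basis] by (simp add: swap_basis algebra_simps)
qed (auto intro: grade_add)

section \<open>Coordinates in positive degrees\<close>

text \<open>
  Every element of \<open>R\<^sub>n\<close>, \<open>n \<ge> 0\<close>, is uniquely a sum of products \<open>x\<^sub>I r\<^sub>I\<close> with \<open>|I| = n\<close>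
  and \<open>r\<^sub>I \<in> R\<^sub>0\<close>. The coordinate \<open>coord I v\<close> is \<open>r\<^sub>I\<close>: it collects the monomials of \<open>v\<close>
  that begin with \<open>x\<^sub>I\<close>, with this prefix removed.
\<close>

lift_definition coord :: "'l list \<Rightarrow> 'l alg \<Rightarrow> 'l alg" is
  "\<lambda>I A. (\<lambda>(K, J). (I @ K, J)) -` A"
  by (rule finite_vimageI) (auto simp: inj_def)

lemma supp_coord: "(K, J) \<in> supp (coord I v) \<longleftrightarrow> (I @ K, J) \<in> supp v"
  by transfer simp

lemma coord_zero [simp]: "coord I 0 = 0"
  and coord_add [simp]: "coord I (u + v) = coord I u + coord I v"
  by (rule alg_eqI; simp add: supp_coord supp_add)+

lemma coord_sum: "coord I (sum f A) = (\<Sum>a\<in>A. coord I (f a))"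
  by (induction A rule: infinite_finite_induct) simp_all

lemma coord_basis_times:
  assumes "length I = length I'"
  shows "coord I (basis I' [] * v) = (if I = I' then v else 0)"
proof (induction v rule: alg_induct)
  case (basis K J)
  show ?case
    using assms by (intro alg_eqI) (auto simp: supp_coord simp flip: basis_x_append)
qed (auto simp: distrib_left)

lemma coord_times:
  assumes "v \<in> grade (int (length I))"
  shows "coord I (v * s) = coord I v * s"
proof (induction v rule: alg_induct)
  case (basis K J)
  define I' where "I' = take (length I) K"
  have "length I \<le> length K"
    using grade_basis[OF assms basis] by simp
  then have len: "length I = length I'" and K: "basis K J = basis I' [] * basis (drop (length I) K) J"
    by (simp_all add: I'_def flip: basis_x_append)
  show ?case
    unfolding K by (simp add: mult.assoc coord_basis_times[OF len])
qed (simp_all add: distrib_right)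

lemma coord_grade: "v \<in> grade k \<Longrightarrow> coord I v \<in> grade (k - int (length I))"
  by (fastforce simp: grade_def deg_def supp_coord)

lemma coord_eqI:
  assumes "u \<in> grade (int n)" "v \<in> grade (int n)"
    and "\<And>I. length I = n \<Longrightarrow> coord I u = coord I v"
  shows "u = v"
proof (rule alg_eqI)
  fix K J
  show "(K, J) \<in> supp u \<longleftrightarrow> (K, J) \<in> supp v"
  proof (cases "n \<le> length K")
    case True
    then have "length (take n K) = n" by simp
    from assms(3)[OF this] show ?thesis
      by (metis append_take_drop_id supp_coord)
  next
    case False
    then show ?thesis using assms(1,2) grade_basis by fastforce
  qed
qed

section \<open>The augmentation of the base ring\<close>

text \<open>The coefficient of the monomial \<open>1\<close>; it is multiplicative on \<open>R\<^sub>0\<close> (\<open>unit_coeff_times\<close>).\<close>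

definition unit_coeff :: "'l alg \<Rightarrow> bool" where
  "unit_coeff v \<longleftrightarrow> ([], []) \<in> supp v"

lemma supp_shift_x: "w \<in> supp (shift_x i v) \<longleftrightarrow> (\<exists>I J. w = (i # I, J) \<and> (I, J) \<in> supp v)"
  by (induction v rule: alg_induct) (auto simp: supp_add)

text \<open>
  A monomial with a leading \<open>x\<close> keeps it under right multiplication.
\<close>

lemma basis_times_x_nonempty:
  assumes "I \<noteq> []" shows "([], L) \<notin> supp (basis I J * v)"
proof -
  obtain i I' where "I = i # I'" using assms by (cases I) auto
  then have "basis I J * v = shift_x i (basis I' J * v)"
    by (simp add: basis_times act_def)
  then show ?thesis by (simp add: supp_shift_x)
qed

text \<open>
  Dually, a trailing \<open>y\<close> survives left multiplication.
\<close>

lemma times_basis_y_nonempty: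
  fixes v :: "'l alg"
  assumes "B \<noteq> []" shows "(L, []) \<notin> supp (v * basis A B)"
proof -
  \<comment> \<open>The elements whose monomials all end in some \<open>y\<close>; they form a left ideal.\<close>
  define N :: "'l alg set" where "N = {v. \<forall>I. (I, []) \<notin> supp v}"
  have N_add: "u \<in> N \<Longrightarrow> w \<in> N \<Longrightarrow> u + w \<in> N" for u w
    by (auto simp: N_def supp_add)
  have N_x: "shift_x i w \<in> N" if "w \<in> N" for i w
    using that by (auto simp: N_def supp_shift_x)
  have N_0: "0 \<in> N" by (simp add: N_def)
  have N_basis: "y_basis i I J \<in> N" if "J \<noteq> []" for i I J
    using that
    by (induction I arbitrary: i) (auto intro!: N_add N_x simp: N_0, auto simp: N_def)
  have N_y: "shift_y i w \<in> N" if "w \<in> N" for i w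
  proof (induction w rule: alg_induct)
    case (basis I J)
    then have "J \<noteq> []" using that by (auto simp: N_def)
    then show ?case by (simp add: N_basis)
  qed (auto simp: N_0 N_add)
  have "v * basis A B \<in> N"
  proof (induction v rule: alg_induct)
    case (basis I J)
    have "basis A B \<in> N" using assms by (auto simp: N_def)
    then have "foldr shift_y J (basis A B) \<in> N" by (induction J) (auto intro: N_y)
    then have "foldr shift_x I (foldr shift_y J (basis A B)) \<in> N" by (induction I) (auto intro: N_x)
    then show ?case by (simp add: basis_times act_def)
  qed (auto simp: N_0 N_add distrib_right)
  then show ?thesis by (simp add: N_def)
qed

text \<open>
  The monomials of \<open>s \<in> R\<^sub>0\<close> other than \<open>1\<close> have a leading \<open>x\<close> and a trailing \<open>y\<close>, so
  modulo the augmentation, multiplication by \<open>s\<close> from the right fixes or kills the coefficients of the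
  monomials \<open>x\<^sub>I\<close>, and multiplication from the left those of the monomials \<open>y\<^sub>J\<close>.
\<close>

lemma pure_x_coeff_times:
  assumes "s \<in> grade 0"
  shows "(I, []) \<in> supp (v * s) \<longleftrightarrow> unit_coeff s \<and> (I, []) \<in> supp v"
proof (induction s rule: alg_induct)
  case (basis A B)
  then have "length A = length B" using grade_basis[OF assms basis] by simp
  then show ?case
    using times_basis_y_nonempty[of B I v A]
    by (cases "B = []") (auto simp: unit_coeff_def)
qed (auto simp: unit_coeff_def distrib_left supp_add)

lemma pure_y_coeff_times:
  assumes "s \<in> grade 0"
  shows "([], J) \<in> supp (s * v) \<longleftrightarrow> unit_coeff s \<and> ([], J) \<in> supp v"
proof (induction s rule: alg_induct)
  case (basis A B)
  then have "length A = length B" using grade_basis[OF assms basis] by simp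
  then show ?case
    using basis_times_x_nonempty[of A J B v]
    by (cases "A = []") (auto simp: unit_coeff_def)
qed (auto simp: unit_coeff_def distrib_right supp_add)

section \<open>The ring on functions between natural numbers\<close>

text \<open>
  An element is encoded by the indicator function of its support, along an enumeration of the
  pairs of words. Finiteness of \<open>'l\<close> serves here only to make these pairs countable.
\<close>

definition enc :: "'l::finite alg \<Rightarrow> nat \<Rightarrow> nat" where
  "enc v = (\<lambda>n. of_bool (from_nat n \<in> supp v))"

lemma inj_enc: "inj enc"
proof (rule injI)
  fix u v :: "'a alg"
  assume eq: "enc u = enc v"
  have "(I, J) \<in> supp u \<longleftrightarrow> (I, J) \<in> supp v" for I J
    using fun_cong[OF eq, of "to_nat (I, J)"] by (simp add: enc_def of_bool_eq_iff)
  then show "u = v" by (rule alg_eqI)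
qed

lemma enc_eq [simp]: "enc u = enc v \<longleftrightarrow> u = v"
  using inj_enc by (auto dest: injD)

text \<open>
  The inverse of the encoding; its values outside the range of \<open>enc\<close> play no role.
\<close>

definition dec :: "(nat \<Rightarrow> nat) \<Rightarrow> 'l::finite alg" where
  "dec = inv_into UNIV enc"

lemma dec_enc [simp]: "dec (enc v) = v"
  by (simp add: dec_def inj_enc)

text \<open>
  The ring structure transported to the encodings of the elements of \<open>H\<close>, which is \<open>UNIV\<close> for the
  whole ring and \<open>grade 0\<close> for the base ring.
\<close>

definition enc_ring :: "'l::finite alg set \<Rightarrow> (nat \<Rightarrow> nat) ring" where
  "enc_ring H = \<lparr> carrier = enc ` H,
     mult = (\<lambda>a b. enc (dec a * (dec b :: 'l alg))), one = enc (1 :: 'l alg),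
     zero = enc (0 :: 'l alg), add = (\<lambda>a b. enc (dec a + (dec b :: 'l alg))) \<rparr>"

lemma enc_ring_simps [simp]:
  fixes H :: "'l::finite alg set" and u v :: "'l alg"
  shows "carrier (enc_ring H) = enc ` H"
  "enc u \<otimes>\<^bsub>enc_ring H\<^esub> enc v = enc (u * v)"
  "enc u \<oplus>\<^bsub>enc_ring H\<^esub> enc v = enc (u + v)"
  "\<one>\<^bsub>enc_ring H\<^esub> = enc (1 :: 'l alg)"
  "\<zero>\<^bsub>enc_ring H\<^esub> = enc (0 :: 'l alg)"
  by (simp_all add: enc_ring_def)

lemma ring_enc_ring: "ring (enc_ring (UNIV :: 'l::finite alg set))"
proof (rule ringI)
  show "abelian_group (enc_ring (UNIV :: 'l alg set))"
  proof (rule abelian_groupI)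
    fix a assume "a \<in> carrier (enc_ring (UNIV :: 'l alg set))"
    then obtain v :: "'l alg" where "a = enc v" by auto
    then show "\<exists>b\<in>carrier (enc_ring (UNIV :: 'l alg set)).
        b \<oplus>\<^bsub>enc_ring (UNIV :: 'l alg set)\<^esub> a = \<zero>\<^bsub>enc_ring (UNIV :: 'l alg set)\<^esub>"
      by (intro bexI[of _ "enc v"]) simp_all
  qed (auto simp: ac_simps)
  show "Group.monoid (enc_ring (UNIV :: 'l alg set))"
    by (rule monoidI) (auto simp: mult.assoc)
qed (auto simp: distrib_left distrib_right)

lemma enc_component_subgroup:
  "additive_subgroup (enc ` (grade k :: 'l::finite alg set)) (enc_ring (UNIV :: 'l alg set))"
proof (rule additive_subgroupI)
  interpret ring "enc_ring (UNIV :: 'l alg set)" by (rule ring_enc_ring)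
  show "subgroup (enc ` (grade k :: 'l alg set)) (add_monoid (enc_ring (UNIV :: 'l alg set)))"
  proof (rule group.subgroupI[OF a_group])
    fix a assume "a \<in> enc ` (grade k :: 'l alg set)"
    then obtain v :: "'l alg" where v: "a = enc v" "v \<in> grade k" by auto
    have "\<ominus>\<^bsub>enc_ring (UNIV :: 'l alg set)\<^esub> enc v = enc v"
      by (rule minus_equality) simp_all
    then show "inv\<^bsub>add_monoid (enc_ring (UNIV :: 'l alg set))\<^esub> a \<in> enc ` (grade k :: 'l alg set)"
      using v by (simp add: a_inv_def)
  next
    fix a b assume "a \<in> enc ` (grade k :: 'l alg set)" "b \<in> enc ` (grade k :: 'l alg set)"
    then show "a \<otimes>\<^bsub>add_monoid (enc_ring (UNIV :: 'l alg set))\<^esub> b \<in> enc ` (grade k :: 'l alg set)"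
      by (auto intro: grade_add)
  qed (auto intro: grade_zero)
qed

lemma enc_finsum:
  fixes f :: "'i \<Rightarrow> 'l::finite alg"
  assumes "finite A"
  shows "(\<Oplus>\<^bsub>enc_ring (UNIV :: 'l alg set)\<^esub>a\<in>A. enc (f a)) = enc (\<Sum>a\<in>A. f a)"
proof -
  interpret ring "enc_ring (UNIV :: 'l alg set)" by (rule ring_enc_ring)
  show ?thesis using assms by (induction A) (auto simp: finsum_insert Pi_def)
qed

lemma enc_Z_graded_ring: "Z_graded_ring (enc_ring (UNIV :: 'l::finite alg set)) (\<lambda>k. enc ` (grade k :: 'l alg set))"
proof (intro Z_graded_ring.intro Z_graded_ring_axioms.intro ring_enc_ring enc_component_subgroup)
  fix a b k l assume "a \<in> enc ` (grade k :: 'l alg set)" "b \<in> enc ` (grade l :: 'l alg set)"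
  then show "a \<otimes>\<^bsub>enc_ring (UNIV :: 'l alg set)\<^esub> b \<in> enc ` (grade (k + l) :: 'l alg set)"
    by (auto intro: grade_times)
next
  let ?R = "enc_ring (UNIV :: 'l alg set)"
  fix a assume "a \<in> carrier ?R"
  then obtain v :: "'l alg" where a: "a = enc v" by auto
  let ?P = "\<lambda>c. (\<forall>k. c k \<in> enc ` (grade k :: 'l alg set)) \<and> finite {k. c k \<noteq> \<zero>\<^bsub>?R\<^esub>} \<and>
      a = (\<Oplus>\<^bsub>?R\<^esub>k\<in>{k. c k \<noteq> \<zero>\<^bsub>?R\<^esub>}. c k)"
  show "\<exists>!c. ?P c"
  proof (rule ex1I[of _ "\<lambda>k. enc (component k v)"])
    have "finite {k. component k v \<noteq> 0}" by (simp add: component_nonzero)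
    then show "?P (\<lambda>k. enc (component k v))"
      by (simp add: a enc_finsum sum_component)
  next
    fix c assume P: "?P c"
    define d :: "int \<Rightarrow> 'l alg" where "d k = dec (c k)" for k
    have cd: "c k = enc (d k) \<and> d k \<in> grade k" for k
    proof -
      from P have "c k \<in> enc ` (grade k :: 'l alg set)" by blast
      then show ?thesis by (auto simp: d_def)
    qed
    have c: "c k = enc (d k)" and d: "d k \<in> grade k" for k
      using cd by blast+
    have fin: "finite {k. d k \<noteq> 0}" using P by (simp add: c)
    have v: "v = (\<Sum>k\<in>{k. d k \<noteq> 0}. d k)"
      using P fin by (simp add: c a enc_finsum)
    \<comment> \<open>Applying the projection onto \<open>R\<^sub>l\<close> to any decomposition of \<open>v\<close> recovers its \<open>l\<close>-th term.\<close>
    have "component l v = d l" for l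
    proof -
      have "component l v = (\<Sum>k\<in>{k. d k \<noteq> 0}. if l = k then d k else 0)"
        unfolding v component_sum by (intro sum.cong refl component_of_grade d)
      also have "\<dots> = d l" using fin by (simp add: sum.delta')
      finally show ?thesis .
    qed
    then show "c = (\<lambda>k. enc (component k v))" by (auto simp: c)
  qed
qed

lemma enc_full_grading:
  "full_grading (enc_ring (UNIV :: 'l::finite alg set)) (\<lambda>k. enc ` (grade k :: 'l alg set))"
  unfolding full_grading_def
proof
  fix k
  obtain I J :: "'l list" where "int (length I) - int (length J) = k"
  proof (cases "0 \<le> k")
    case True
    then show ?thesis by (intro that[of "replicate (nat k) undefined" "[]"]) simp
  next
    case False
    then show ?thesis by (intro that[of "[]" "replicate (nat (- k)) undefined"]) simp
  qed
  then have "enc (basis I J) \<in> enc ` (grade k :: 'l alg set)" by simp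
  moreover have "basis I J \<noteq> 0" by (metis insert_not_empty supp_basis supp_zero)
  then have "enc (basis I J) \<notin> {\<zero>\<^bsub>enc_ring (UNIV :: 'l alg set)\<^esub>}" by simp
  ultimately show "enc ` (grade k :: 'l alg set) \<noteq> {\<zero>\<^bsub>enc_ring (UNIV :: 'l alg set)\<^esub>}"
    by blast
qed

lemma base_ring_enc:
  "base_ring (enc_ring (UNIV :: 'l alg set)) (\<lambda>k. enc ` (grade k :: 'l::finite alg set))
    = enc_ring (grade 0 :: 'l alg set)"
  by (simp add: base_ring_def enc_ring_def)

section \<open>Counting modulo the augmentation ideal\<close>

lemma unit_coeff_simps [simp]: "unit_coeff 1" "\<not> unit_coeff 0"
  "unit_coeff (s + t) \<longleftrightarrow> unit_coeff s \<noteq> unit_coeff t"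
  by (auto simp: unit_coeff_def supp_add)

lemma unit_coeff_times: "s \<in> grade 0 \<Longrightarrow> unit_coeff (t * s) \<longleftrightarrow> unit_coeff s \<and> unit_coeff t"
  using pure_x_coeff_times[of s "[]" t] by (simp add: unit_coeff_def)

text \<open>
  The counting principle. Let \<open>P\<close> be the left or right module \<open>R\<^sub>0\<^sup>n\<close>, let \<open>g\<close> be linear on
  \<open>P\<close>, and let \<open>\<Lambda>\<close> be additive modulo two on the target and semilinear along the augmentation.
  Then \<open>\<Lambda> (g u)\<close> depends only on the augmentations of the \<open>n\<close> entries of \<open>u\<close>, so it takes at
  most \<open>2\<^sup>n\<close> values. Values of \<open>\<Lambda>\<close> are sets, which stand for vectors over the field with two
  elements. The hypothesis \<open>unit\<close> is the only property of the scalar multiplication of \<open>P\<close> that is needed,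
  and it holds on both sides.
\<close>

lemma card_coefficient_sets:
  fixes P :: "(nat \<Rightarrow> nat, nat \<Rightarrow> nat \<Rightarrow> nat, 'p) module_scheme"
    and M :: "(nat \<Rightarrow> nat, 'm, 'q) module_scheme" and \<Lambda> :: "'m \<Rightarrow> 'c set"
  assumes carrier: "carrier P = {..<n} \<rightarrow>\<^sub>E enc ` (grade 0 :: 'l::finite alg set)"
    and add: "\<And>u v. add P u v = (\<lambda>i\<in>{..<n}. u i \<oplus>\<^bsub>enc_ring (grade 0 :: 'l alg set)\<^esub> v i)"
    and unit: "\<And>l s :: 'l alg. l < n \<Longrightarrow> s \<in> grade 0 \<Longrightarrow>
      enc s \<odot>\<^bsub>P\<^esub> (\<lambda>i\<in>{..<n}. enc (if i = l then 1 else 0 :: 'l alg))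
        = (\<lambda>i\<in>{..<n}. enc (if i = l then s else 0))"
    and g: "g \<in> module_hom (enc_ring (grade 0 :: 'l alg set)) P M"
    and \<Lambda>_add: "\<And>a b. a \<in> carrier M \<Longrightarrow> b \<in> carrier M \<Longrightarrow> \<Lambda> (a \<oplus>\<^bsub>M\<^esub> b) = sym_diff (\<Lambda> a) (\<Lambda> b)"
    and \<Lambda>_smult: "\<And>s a. (s :: 'l alg) \<in> grade 0 \<Longrightarrow> a \<in> carrier M \<Longrightarrow>
      \<Lambda> (enc s \<odot>\<^bsub>M\<^esub> a) = (if unit_coeff s then \<Lambda> a else {})"
  shows "finite (\<Lambda> ` g ` carrier P)" "card (\<Lambda> ` g ` carrier P) \<le> 2 ^ n"
proof -
  \<comment> \<open>A tuple is assembled from its entries one at a time: \<open>trunc m w\<close> has the first \<open>m\<close>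
    entries of \<open>w\<close>, and \<open>e l\<close> is the \<open>l\<close>-th unit vector.\<close>
  define trunc :: "nat \<Rightarrow> (nat \<Rightarrow> 'l alg) \<Rightarrow> nat \<Rightarrow> nat \<Rightarrow> nat"
    where "trunc m w = (\<lambda>i\<in>{..<n}. enc (if i < m then w i else 0))" for m w
  define e :: "nat \<Rightarrow> nat \<Rightarrow> nat \<Rightarrow> nat"
    where "e l = (\<lambda>i\<in>{..<n}. enc (if i = l then 1 else 0 :: 'l alg))" for l
  have trunc_in: "trunc m w \<in> carrier P" if "\<And>i. w i \<in> grade 0" for m w
    using that by (auto simp: trunc_def carrier)
  have e_in: "e l \<in> carrier P" for l
    by (auto simp: e_def carrier)
  have single_in: "enc s \<odot>\<^bsub>P\<^esub> e l \<in> carrier P" if "l < n" "s \<in> grade 0" for l and s :: "'l alg"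
    using that by (auto simp: e_def unit carrier)
  have gM: "g u \<in> carrier M" if "u \<in> carrier P" for u
    using g that by (auto simp: module_hom_def)
  have step: "\<Lambda> (g (trunc (Suc m) w))
      = sym_diff (\<Lambda> (g (trunc m w))) (if unit_coeff (w m) then \<Lambda> (g (e m)) else {})"
    if w: "\<And>i. w i \<in> grade 0" and "m < n" for m w
  proof -
    have "trunc (Suc m) w = trunc m w \<oplus>\<^bsub>P\<^esub> (enc (w m) \<odot>\<^bsub>P\<^esub> e m)"
      using \<open>m < n\<close> by (auto simp: add trunc_def e_def unit w less_Suc_eq)
    moreover have "g (trunc m w \<oplus>\<^bsub>P\<^esub> (enc (w m) \<odot>\<^bsub>P\<^esub> e m)) = g (trunc m w) \<oplus>\<^bsub>M\<^esub> (enc (w m) \<odot>\<^bsub>M\<^esub> g (e m))"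
      and "g (enc (w m) \<odot>\<^bsub>P\<^esub> e m) = enc (w m) \<odot>\<^bsub>M\<^esub> g (e m)"
      using g trunc_in[OF w] single_in[OF \<open>m < n\<close> w] e_in w
      by (auto simp: module_hom_def)
    moreover from this have "enc (w m) \<odot>\<^bsub>M\<^esub> g (e m) \<in> carrier M"
      using gM[OF single_in[OF \<open>m < n\<close>, of "w m"]] w by simp
    ultimately show ?thesis
      using gM[OF trunc_in[of w m]] gM[OF e_in[of m]] w
      by (simp add: \<Lambda>_add \<Lambda>_smult)
  qed
  have trunc_cong: "\<Lambda> (g (trunc m w)) = \<Lambda> (g (trunc m w'))"
    if "\<And>i. w i \<in> grade 0" "\<And>i. w' i \<in> grade 0" "\<And>i. i < n \<Longrightarrow> unit_coeff (w i) = unit_coeff (w' i)"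
      and "m \<le> n" for m w w'
    using \<open>m \<le> n\<close>
  proof (induction m)
    case 0
    then show ?case by (simp add: trunc_def)
  next
    case (Suc m)
    then show ?case using that by (simp add: step)
  qed
  \<comment> \<open>One representative for each pattern of augmentations.\<close>
  define h where "h D = \<Lambda> (g (trunc n (\<lambda>i. if i \<in> D then 1 else 0)))" for D
  have sub: "\<Lambda> ` g ` carrier P \<subseteq> h ` Pow {..<n}"
  proof clarify
    fix u assume u: "u \<in> carrier P"
    define w :: "nat \<Rightarrow> 'l alg" where "w i = (if i < n then dec (u i) else 0)" for i
    have ui: "\<exists>v. (v :: 'l alg) \<in> grade 0 \<and> u i = enc v" if "i < n" for i
      using u that by (auto simp: carrier PiE_iff)
    have w: "w i \<in> grade 0" for i
      using ui[of i] by (auto simp: w_def)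
    have "u = trunc n w"
    proof
      fix i show "u i = trunc n w i"
        using u ui[of i] by (auto simp: trunc_def w_def carrier PiE_iff extensional_def)
    qed
    moreover have "\<Lambda> (g (trunc n w)) = h {i\<in>{..<n}. unit_coeff (w i)}"
      unfolding h_def by (rule trunc_cong) (auto simp: w)
    ultimately have "\<Lambda> (g u) = h {i\<in>{..<n}. unit_coeff (w i)}" by simp
    then show "\<Lambda> (g u) \<in> h ` Pow {..<n}" by blast
  qed
  have fin: "finite (h ` Pow {..<n})" by simp
  show "finite (\<Lambda> ` g ` carrier P)" by (rule finite_subset[OF sub fin])
  have "card (\<Lambda> ` g ` carrier P) \<le> card (h ` Pow {..<n})" by (rule card_mono[OF fin sub])
  also have "\<dots> \<le> card (Pow {..<n})" by (rule card_image_le) simp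
  finally show "card (\<Lambda> ` g ` carrier P) \<le> 2 ^ n" by (simp add: card_Pow)
qed

lemma right_power_simps:
  "carrier (right_power S n) = {..<n} \<rightarrow>\<^sub>E carrier S"
  "add (right_power S n) = (\<lambda>u v. \<lambda>i\<in>{..<n}. u i \<oplus>\<^bsub>S\<^esub> v i)"
  "s \<odot>\<^bsub>right_power S n\<^esub> u = (\<lambda>i\<in>{..<n}. u i \<otimes>\<^bsub>S\<^esub> s)"
  by (simp_all add: right_power_def)

lemma left_power_simps:
  "carrier (left_power S n) = {..<n} \<rightarrow>\<^sub>E carrier S"
  "add (left_power S n) = (\<lambda>u v. \<lambda>i\<in>{..<n}. u i \<oplus>\<^bsub>S\<^esub> v i)"
  "s \<odot>\<^bsub>left_power S n\<^esub> u = (\<lambda>i\<in>{..<n}. s \<otimes>\<^bsub>S\<^esub> u i)"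
  by (simp_all add: left_power_def)

lemma right_component_simps:
  "carrier (right_component R G k) = G k"
  "add (right_component R G k) = add R"
  "s \<odot>\<^bsub>right_component R G k\<^esub> u = u \<otimes>\<^bsub>R\<^esub> s"
  by (simp_all add: right_component_def)

lemma left_component_simps:
  "carrier (left_component R G k) = G k"
  "add (left_component R G k) = add R"
  "s \<odot>\<^bsub>left_component R G k\<^esub> u = s \<otimes>\<^bsub>R\<^esub> u"
  by (simp_all add: left_component_def)

lemma UGN_base: "UGN (enc_ring (grade 0 :: 'l::finite alg set))"
  unfolding UGN_def
proof (intro allI impI notI)
  let ?S = "enc_ring (grade 0 :: 'l alg set)"
  fix n assume "\<exists>f. f \<in> module_epi ?S (right_power ?S n) (right_power ?S (n + 1))"
  then obtain f where f: "f \<in> module_hom ?S (right_power ?S n) (right_power ?S (n + 1))"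
      and surj: "f ` carrier (right_power ?S n) = carrier (right_power ?S (n + 1))"
    by (auto simp: module_epi_def)
  define \<Lambda> where "\<Lambda> v = {l\<in>{..<n + 1}. unit_coeff (dec (v l) :: 'l alg)}" for v
  have entry: "\<exists>w. (w :: 'l alg) \<in> grade 0 \<and> v l = enc w"
    if "v \<in> carrier (right_power ?S (n + 1))" "l < n + 1" for v l
    using that by (auto simp: right_power_simps PiE_iff)
  have "card (\<Lambda> ` f ` carrier (right_power ?S n)) \<le> 2 ^ n"
  proof (rule card_coefficient_sets(2)[OF _ _ _ f])
    fix a b assume a: "a \<in> carrier (right_power ?S (n + 1))" and b: "b \<in> carrier (right_power ?S (n + 1))"
    have "unit_coeff (dec (a l \<oplus>\<^bsub>?S\<^esub> b l) :: 'l alg) \<longleftrightarrow>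
        unit_coeff (dec (a l) :: 'l alg) \<noteq> unit_coeff (dec (b l) :: 'l alg)" if "l < n + 1" for l
      using entry[OF a that] entry[OF b that] by auto
    then show "\<Lambda> (a \<oplus>\<^bsub>right_power ?S (n + 1)\<^esub> b) = sym_diff (\<Lambda> a) (\<Lambda> b)"
      by (auto simp: \<Lambda>_def right_power_simps)
  next
    fix s :: "'l alg" and a
    assume s: "s \<in> grade 0" and a: "a \<in> carrier (right_power ?S (n + 1))"
    have "unit_coeff (dec (a l \<otimes>\<^bsub>?S\<^esub> enc s) :: 'l alg) \<longleftrightarrow>
        unit_coeff s \<and> unit_coeff (dec (a l) :: 'l alg)" if "l < n + 1" for l
      using entry[OF a that] s by (auto simp: unit_coeff_times)
    then show "\<Lambda> (enc s \<odot>\<^bsub>right_power ?S (n + 1)\<^esub> a) = (if unit_coeff s then \<Lambda> a else {})"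
      by (auto simp: \<Lambda>_def right_power_simps)
  qed (auto simp: right_power_simps fun_eq_iff)
  moreover have "\<Lambda> ` carrier (right_power ?S (n + 1)) = Pow {..<n + 1}"
  proof
    show "Pow {..<n + 1} \<subseteq> \<Lambda> ` carrier (right_power ?S (n + 1))"
    proof
      fix D assume "D \<in> Pow {..<n + 1}"
      let ?v = "\<lambda>i\<in>{..<n + 1}. enc (if i \<in> D then 1 else 0 :: 'l alg)"
      have "\<Lambda> ?v = D"
        using \<open>D \<in> Pow {..<n + 1}\<close> by (auto simp: \<Lambda>_def split: if_splits)
      moreover have "?v \<in> carrier (right_power ?S (n + 1))"
        by (auto simp: right_power_simps)
      ultimately show "D \<in> \<Lambda> ` carrier (right_power ?S (n + 1))" by blast
    qed
  qed (auto simp: \<Lambda>_def)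
  ultimately have "card (Pow {..<n + 1}) \<le> 2 ^ n"
    by (simp add: surj)
  then show False by (simp add: card_Pow)
qed

text \<open>
  The map \<open>(r, s) \<mapsto> (x\<^sub>i r + y\<^sub>i s)\<^sub>i\<close> from \<open>R\<^sup>2\<close> to \<open>R\<^sup>3\<close> has the right inverse
  \<open>c \<mapsto> (\<Sum>\<^sub>k y\<^sub>k c\<^sub>k, \<Sum>\<^sub>k x\<^sub>k c\<^sub>k)\<close>, by the defining relations.
\<close>

lemma BGN_total:
  assumes "CARD('l::finite) = 3"
  shows "BGN (enc_ring (UNIV :: 'l alg set))"
proof -
  let ?R = "enc_ring (UNIV :: 'l alg set)"
  obtain e :: "nat \<Rightarrow> 'l" where "bij_betw e {..<3} UNIV"
    using ex_bij_betw_nat_finite[of "UNIV :: 'l set"] assms by (auto simp: atLeast0LessThan)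
  then have inj: "e i = e k \<longleftrightarrow> i = k" if "i < 3" "k < 3" for i k
    using that by (auto simp: bij_betw_def inj_on_def)
  define f :: "(nat \<Rightarrow> nat \<Rightarrow> nat) \<Rightarrow> nat \<Rightarrow> nat \<Rightarrow> nat"
    where "f u = (\<lambda>i\<in>{..<3}. enc (x_gen (e i) * dec (u 0) + y_gen (e i) * dec (u 1)))" for u
  have entry: "\<exists>w :: 'l alg. v l = enc w" if "v \<in> carrier (right_power ?R n)" "l < n" for v l n
    using that by (auto simp: right_power_simps PiE_iff)
  have "f \<in> module_hom ?R (right_power ?R 2) (right_power ?R 3)"
    unfolding module_hom_def
  proof (intro CollectI conjI ballI)
    show "f \<in> carrier (right_power ?R 2) \<rightarrow> carrier (right_power ?R 3)"
      by (auto simp: f_def right_power_simps)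
  next
    fix u v assume u: "u \<in> carrier (right_power ?R 2)" and v: "v \<in> carrier (right_power ?R 2)"
    obtain u0 u1 v0 v1 :: "'l alg" where "u 0 = enc u0" "u 1 = enc u1" "v 0 = enc v0" "v 1 = enc v1"
      using entry[OF u, of 0] entry[OF u, of 1] entry[OF v, of 0] entry[OF v, of 1] by auto
    then show "f (u \<oplus>\<^bsub>right_power ?R 2\<^esub> v) = f u \<oplus>\<^bsub>right_power ?R 3\<^esub> f v"
      by (simp add: f_def right_power_simps(2) distrib_left ac_simps cong: restrict_cong)
  next
    fix s u assume "s \<in> carrier ?R" and u: "u \<in> carrier (right_power ?R 2)"
    then obtain t :: "'l alg" where "s = enc t" by auto
    moreover obtain u0 u1 :: "'l alg" where "u 0 = enc u0" "u 1 = enc u1"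
      using entry[OF u, of 0] entry[OF u, of 1] by auto
    ultimately show "f (s \<odot>\<^bsub>right_power ?R 2\<^esub> u) = s \<odot>\<^bsub>right_power ?R 3\<^esub> f u"
      by (simp add: f_def right_power_simps(3) distrib_right mult.assoc cong: restrict_cong)
  qed
  moreover have "c \<in> f ` carrier (right_power ?R 2)" if c: "c \<in> carrier (right_power ?R 3)" for c
  proof (rule image_eqI)
    define d :: "nat \<Rightarrow> 'l alg" where "d k = dec (c k)" for k
    have cd: "c k = enc (d k)" if "k < 3" for k
      using entry[OF c that] by (auto simp: d_def)
    let ?u = "\<lambda>j\<in>{..<2::nat}. enc (\<Sum>k<3. (if j = 0 then y_gen (e k) else x_gen (e k)) * d k)"
    show "?u \<in> carrier (right_power ?R 2)" by (auto simp: right_power_simps)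
    have "x_gen (e i) * (\<Sum>k<3. y_gen (e k) * d k) + y_gen (e i) * (\<Sum>k<3. x_gen (e k) * d k) = d i"
      if "i < 3" for i
    proof -
      have "x_gen (e i) * (\<Sum>k<3. y_gen (e k) * d k) + y_gen (e i) * (\<Sum>k<3. x_gen (e k) * d k)
          = (\<Sum>k<3. if e i = e k then d k else 0)"
        by (simp only: sum_distrib_left sum.distrib[symmetric] generator_relation)
      also have "\<dots> = (\<Sum>k<3. if i = k then d k else 0)"
        using that by (intro sum.cong refl) (simp add: inj)
      also have "\<dots> = d i" using that by (simp add: sum.delta')
      finally show ?thesis .
    qed
    then show "c = f ?u"
      using c by (auto simp: f_def right_power_simps fun_eq_iff PiE_iff extensional_def cd)
  qed
  moreover from calculation(1) have "f ` carrier (right_power ?R 2) \<subseteq> carrier (right_power ?R 3)"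
    by (auto simp: module_hom_def)
  ultimately have "f \<in> module_epi ?R (right_power ?R 2) (right_power ?R (2 + 1))"
    by (auto simp: module_epi_def)
  then show ?thesis
    unfolding BGN_def UGN_def by (metis zero_less_numeral)
qed

section \<open>Freeness of the components\<close>

text \<open>
  An involutive automorphism \<open>\<tau>\<close> that preserves \<open>R\<^sub>0\<close> and exchanges \<open>R\<^sub>k\<close> with \<open>R\<^sub>n\<close>, \<open>n \<ge> 0\<close>,
  carries the coordinates on \<open>R\<^sub>n\<close> to \<open>R\<^sub>k\<close>. Applying \<open>\<tau>\<close> once more to the coordinates makes the
  resulting map linear over \<open>R\<^sub>0\<close> without a twist. It is used with the identity for \<open>k \<ge> 0\<close> and with
  \<open>swap\<close> for \<open>k < 0\<close>.
\<close>

lemma right_component_iso_via_symmetry: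
  fixes \<tau> :: "'l::finite alg \<Rightarrow> 'l alg"
  assumes add: "\<And>u v. \<tau> (u + v) = \<tau> u + \<tau> v"
    and times: "\<And>u v. \<tau> (u * v) = \<tau> u * \<tau> v"
    and invol: "\<And>v. \<tau> (\<tau> v) = v"
    and grade_0: "\<And>v. v \<in> grade 0 \<Longrightarrow> \<tau> v \<in> grade 0"
    and grade_k: "\<And>v. v \<in> grade k \<longleftrightarrow> \<tau> v \<in> grade (int n)"
  shows "right_component_iso (enc_ring (UNIV :: 'l alg set)) (\<lambda>k. enc ` (grade k :: 'l alg set)) k
           (CARD('l) ^ n)"
proof -
  let ?R = "enc_ring (UNIV :: 'l alg set)" and ?G = "\<lambda>k. enc ` (grade k :: 'l alg set)"
  let ?S = "enc_ring (grade 0 :: 'l alg set)"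
  define N where "N = CARD('l) ^ n"
  have cardN: "card {I :: 'l list. length I = n} = N"
    using card_lists_length_eq[of "UNIV :: 'l set" n] by (simp add: N_def)
  have fin: "finite {I :: 'l list. length I = n}"
    using finite_lists_length_eq[of "UNIV :: 'l set" n] by simp
  obtain e where e: "bij_betw e {..<N} {I :: 'l list. length I = n}"
    using ex_bij_betw_nat_finite[OF fin] by (auto simp: cardN atLeast0LessThan)
  have len: "length (e i) = n" if "i < N" for i
    using e that by (auto simp: bij_betw_def)
  define f :: "(nat \<Rightarrow> nat) \<Rightarrow> nat \<Rightarrow> nat \<Rightarrow> nat"
    where "f a = (\<lambda>i\<in>{..<N}. enc (\<tau> (coord (e i) (\<tau> (dec a)))))" for a
  have in_0: "\<tau> (coord (e i) (\<tau> v)) \<in> grade 0" if "v \<in> grade k" "i < N" for v i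
    using coord_grade[of "\<tau> v" "int n" "e i"] that len grade_k by (auto intro!: grade_0)
  have "f \<in> module_hom ?S (right_component ?R ?G k) (right_power ?S N)"
    unfolding module_hom_def
  proof (intro CollectI conjI ballI)
    show "f \<in> carrier (right_component ?R ?G k) \<rightarrow> carrier (right_power ?S N)"
      using in_0 by (auto simp: f_def right_power_simps right_component_simps)
  next
    fix a b assume "a \<in> carrier (right_component ?R ?G k)" "b \<in> carrier (right_component ?R ?G k)"
    then show "f (a \<oplus>\<^bsub>right_component ?R ?G k\<^esub> b) = f a \<oplus>\<^bsub>right_power ?S N\<^esub> f b"
      by (auto simp: f_def right_power_simps right_component_simps add)
  next
    fix s a assume "s \<in> carrier ?S" "a \<in> carrier (right_component ?R ?G k)"
    then obtain t v :: "'l alg" where "s = enc t" and v: "a = enc v" "v \<in> grade k"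
      by (auto simp: right_component_simps)
    moreover have "coord (e i) (\<tau> v * \<tau> t) = coord (e i) (\<tau> v) * \<tau> t" if "i < N" for i
      using v grade_k len[OF that] by (intro coord_times) auto
    ultimately show "f (s \<odot>\<^bsub>right_component ?R ?G k\<^esub> a) = s \<odot>\<^bsub>right_power ?S N\<^esub> f a"
      by (auto simp: f_def right_power_simps right_component_simps times invol)
  qed
  moreover have "bij_betw f (carrier (right_component ?R ?G k)) (carrier (right_power ?S N))"
    unfolding bij_betw_def
  proof
    show "inj_on f (carrier (right_component ?R ?G k))"
    proof (rule inj_onI)
      fix a b assume "a \<in> carrier (right_component ?R ?G k)" "b \<in> carrier (right_component ?R ?G k)"
        and eq: "f a = f b"
      then obtain u v :: "'l alg" where uv: "a = enc u" "b = enc v" "u \<in> grade k" "v \<in> grade k"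
        by (auto simp: right_component_simps)
      have "\<tau> u = \<tau> v"
      proof (rule coord_eqI)
        show "\<tau> u \<in> grade (int n)" "\<tau> v \<in> grade (int n)" using uv grade_k by auto
        fix I :: "'l list" assume "length I = n"
        then obtain i where i: "i < N" "I = e i" using e by (auto simp: bij_betw_def)
        have "\<tau> (coord (e i) (\<tau> u)) = \<tau> (coord (e i) (\<tau> v))"
          using fun_cong[OF eq, of i] i by (simp add: f_def uv)
        then show "coord I (\<tau> u) = coord I (\<tau> v)" by (metis i(2) invol)
      qed
      then show "a = b" by (metis invol uv(1,2))
    qed
    show "f ` carrier (right_component ?R ?G k) = carrier (right_power ?S N)"
    proof
      show "carrier (right_power ?S N) \<subseteq> f ` carrier (right_component ?R ?G k)"
      proof
        fix c assume c: "c \<in> carrier (right_power ?S N)"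
        define d :: "nat \<Rightarrow> 'l alg" where "d i = dec (c i)" for i
        have cd: "c i = enc (d i) \<and> d i \<in> grade 0" if "i < N" for i
        proof -
          have "c i \<in> enc ` (grade 0 :: 'l alg set)"
            using c that by (auto simp: right_power_simps)
          then show ?thesis by (auto simp: d_def)
        qed
        define w where "w = (\<Sum>i<N. basis (e i) [] * \<tau> (d i))"
        have "w \<in> grade (int n)"
          unfolding w_def
        proof (rule grade_sum)
          fix i assume "i \<in> {..<N}"
          then have "basis (e i) [] * \<tau> (d i) \<in> grade (int n + 0)"
            using cd[of i] by (intro grade_times grade_0) (auto simp: len)
          then show "basis (e i) [] * \<tau> (d i) \<in> grade (int n)" by simp
        qed
        then have "enc (\<tau> w) \<in> carrier (right_component ?R ?G k)"
          by (auto simp: right_component_simps grade_k invol)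
        moreover have "coord (e i) w = \<tau> (d i)" if "i < N" for i
        proof -
          have "coord (e i) w = (\<Sum>j<N. if i = j then \<tau> (d j) else 0)"
            unfolding w_def coord_sum
          proof (intro sum.cong refl)
            fix j assume "j \<in> {..<N}"
            then have "e i = e j \<longleftrightarrow> i = j" using e that by (auto simp: bij_betw_def inj_on_def)
            then show "coord (e i) (basis (e j) [] * \<tau> (d j)) = (if i = j then \<tau> (d j) else 0)"
              using that \<open>j \<in> {..<N}\<close> by (subst coord_basis_times) (auto simp: len)
          qed
          also have "\<dots> = \<tau> (d i)" using that by (simp add: sum.delta')
          finally show ?thesis .
        qed
        then have "f (enc (\<tau> w)) = c"
          using c cd by (auto simp: f_def invol right_power_simps fun_eq_iff PiE_iff extensional_def)
        ultimately show "c \<in> f ` carrier (right_component ?R ?G k)" by blast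
      qed
    qed (use in_0 in \<open>auto simp: f_def right_power_simps right_component_simps\<close>)
  qed
  ultimately show ?thesis
    unfolding right_component_iso_def module_isomorphic_def base_ring_enc N_def by blast
qed

lemma right_component_iso_enc:
  "right_component_iso (enc_ring (UNIV :: 'l::finite alg set)) (\<lambda>k. enc ` (grade k :: 'l alg set)) k
     (CARD('l) ^ nat \<bar>k\<bar>)"
proof (cases "0 \<le> k")
  case True
  then show ?thesis by (intro right_component_iso_via_symmetry[where \<tau> = "\<lambda>v. v"]) simp_all
next
  case False
  have "v \<in> grade k \<longleftrightarrow> swap v \<in> grade (- k)" for v :: "'l alg"
    using swap_grade[of v k] swap_grade[of "swap v" "- k"] by auto
  then show ?thesis
    using False swap_grade[of _ 0]
    by (intro right_component_iso_via_symmetry[where \<tau> = swap]) (simp_all add: swap_times)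
qed

lemma inverse_module_hom:
  assumes f: "f \<in> module_hom S M N" and bij: "bij_betw f (carrier M) (carrier N)"
    and add: "\<And>a b. a \<in> carrier M \<Longrightarrow> b \<in> carrier M \<Longrightarrow> a \<oplus>\<^bsub>M\<^esub> b \<in> carrier M"
    and smult: "\<And>s a. s \<in> carrier S \<Longrightarrow> a \<in> carrier M \<Longrightarrow> s \<odot>\<^bsub>M\<^esub> a \<in> carrier M"
  shows "inv_into (carrier M) f \<in> module_hom S N M"
proof -
  let ?g = "inv_into (carrier M) f"
  have g: "?g v \<in> carrier M" "f (?g v) = v" if "v \<in> carrier N" for v
    using that bij by (auto simp: bij_betw_def inv_into_into f_inv_into_f)
  have gf: "?g (f a) = a" if "a \<in> carrier M" for a
    using that bij by (simp add: bij_betw_def)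
  show ?thesis
    unfolding module_hom_def
  proof (intro CollectI conjI ballI)
    fix u v assume "u \<in> carrier N" "v \<in> carrier N"
    then have "f (?g u \<oplus>\<^bsub>M\<^esub> ?g v) = u \<oplus>\<^bsub>N\<^esub> v" and "?g u \<oplus>\<^bsub>M\<^esub> ?g v \<in> carrier M"
      using f by (auto simp: module_hom_def g add)
    then show "?g (u \<oplus>\<^bsub>N\<^esub> v) = ?g u \<oplus>\<^bsub>M\<^esub> ?g v" using gf by metis
  next
    fix s v assume "s \<in> carrier S" "v \<in> carrier N"
    then have "f (s \<odot>\<^bsub>M\<^esub> ?g v) = s \<odot>\<^bsub>N\<^esub> v" and "s \<odot>\<^bsub>M\<^esub> ?g v \<in> carrier M"
      using f by (auto simp: module_hom_def g smult)
    then show "?g (s \<odot>\<^bsub>N\<^esub> v) = s \<odot>\<^bsub>M\<^esub> ?g v" using gf by metis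
  qed (use g in auto)
qed

text \<open>
  Let \<open>M\<close> be \<open>R\<^sub>k\<close> as a left or right \<open>R\<^sub>0\<close>-module, isomorphic to \<open>P = R\<^sub>0\<^sup>i\<close>, and let \<open>pure\<close>
  select monomials whose coefficients are semilinear along the augmentation. The set of words whose
  monomial occurs takes at least the values \<open>{I}\<close> with \<open>|I| = n\<close> on \<open>M\<close>, and at most \<open>2\<^sup>i\<close>
  values by the counting principle.
\<close>

lemma rank_lower_bound:
  fixes P :: "(nat \<Rightarrow> nat, nat \<Rightarrow> nat \<Rightarrow> nat, 'p) module_scheme"
    and M :: "(nat \<Rightarrow> nat, nat \<Rightarrow> nat, 'q) module_scheme" and pure :: "'l::finite list \<Rightarrow> 'l list \<times> 'l list"
  assumes carrier: "carrier P = {..<i} \<rightarrow>\<^sub>E enc ` (grade 0 :: 'l alg set)"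
    and add: "\<And>u v. add P u v = (\<lambda>i\<in>{..<i}. u i \<oplus>\<^bsub>enc_ring (grade 0 :: 'l alg set)\<^esub> v i)"
    and unit: "\<And>l s :: 'l alg. l < i \<Longrightarrow> s \<in> grade 0 \<Longrightarrow>
      enc s \<odot>\<^bsub>P\<^esub> (\<lambda>j\<in>{..<i}. enc (if j = l then 1 else 0 :: 'l alg))
        = (\<lambda>j\<in>{..<i}. enc (if j = l then s else 0))"
    and M: "carrier M = enc ` (grade k :: 'l alg set)"
    and M_add: "add M = add (enc_ring (UNIV :: 'l alg set))"
    and M_smult: "\<And>s v. (s :: 'l alg) \<in> grade 0 \<Longrightarrow> (v :: 'l alg) \<in> grade k \<Longrightarrow>
      \<exists>t\<in>grade k. enc s \<odot>\<^bsub>M\<^esub> enc v = enc t \<and> (\<forall>I. pure I \<in> supp t \<longleftrightarrow> unit_coeff s \<and> pure I \<in> supp v)"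
    and pure: "inj pure" "\<And>I. length I = n \<Longrightarrow> deg (pure I) = k"
    and iso: "module_isomorphic (enc_ring (grade 0 :: 'l alg set)) M P"
  shows "CARD('l) ^ n \<le> 2 ^ i"
proof -
  let ?S = "enc_ring (grade 0 :: 'l alg set)"
  obtain f where f: "f \<in> module_hom ?S M P" and bij: "bij_betw f (carrier M) (carrier P)"
    using iso by (auto simp: module_isomorphic_def)
  define g where "g = inv_into (carrier M) f"
  have g: "g \<in> module_hom ?S P M"
    unfolding g_def
  proof (rule inverse_module_hom[OF f bij])
    fix s a assume "s \<in> carrier ?S" "a \<in> carrier M"
    then show "s \<odot>\<^bsub>M\<^esub> a \<in> carrier M" using M_smult by (fastforce simp: M)
  qed (auto simp: M M_add grade_add)
  have surj: "g ` carrier P = carrier M"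
    using bij_betw_inv_into[OF bij] by (simp add: g_def bij_betw_def)
  define \<Lambda> where "\<Lambda> a = {I. pure I \<in> supp (dec a :: 'l alg)}" for a
  have \<Lambda>_add: "\<Lambda> (a \<oplus>\<^bsub>M\<^esub> b) = sym_diff (\<Lambda> a) (\<Lambda> b)"
    if "a \<in> carrier M" "b \<in> carrier M" for a b
    using that by (auto simp: \<Lambda>_def M M_add supp_add)
  have \<Lambda>_smult: "\<Lambda> (enc s \<odot>\<^bsub>M\<^esub> a) = (if unit_coeff s then \<Lambda> a else {})"
    if s: "s \<in> grade 0" and a: "a \<in> carrier M" for s :: "'l alg" and a
  proof -
    obtain v :: "'l alg" where v: "a = enc v" "v \<in> grade k" using a by (auto simp: M)
    obtain t where "enc s \<odot>\<^bsub>M\<^esub> enc v = enc t"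
        "\<And>I. pure I \<in> supp t \<longleftrightarrow> unit_coeff s \<and> pure I \<in> supp v"
      using M_smult[OF s v(2)] by blast
    then show ?thesis by (simp add: \<Lambda>_def v(1))
  qed
  have "finite (\<Lambda> ` g ` carrier P)" and le: "card (\<Lambda> ` g ` carrier P) \<le> 2 ^ i"
    using card_coefficient_sets[where \<Lambda> = \<Lambda>, OF carrier add unit g \<Lambda>_add \<Lambda>_smult] by simp_all
  moreover have "(\<lambda>I. {I}) ` {I. length I = n} \<subseteq> \<Lambda> ` g ` carrier P"
  proof clarify
    fix I :: "'l list" assume "n = length I"
    then have "basis (fst (pure I)) (snd (pure I)) \<in> grade k"
      using pure(2)[of I] by (simp add: deg_def)
    moreover have "\<Lambda> (enc (basis (fst (pure I)) (snd (pure I)))) = {I}"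
      using pure(1) by (auto simp: \<Lambda>_def inj_eq)
    ultimately show "{I} \<in> \<Lambda> ` g ` carrier P"
      unfolding surj M by (metis imageI)
  qed
  ultimately have "card ((\<lambda>I. {I}) ` {I :: 'l list. length I = n}) \<le> 2 ^ i"
    using le by (meson card_mono order_trans)
  moreover have "card ((\<lambda>I. {I}) ` {I :: 'l list. length I = n}) = CARD('l) ^ n"
    using card_lists_length_eq[of "UNIV :: 'l set" n] by (simp add: card_image)
  ultimately show ?thesis by simp
qed

lemma right_component_rank:
  assumes "right_component_iso (enc_ring (UNIV :: 'l::finite alg set)) (\<lambda>k. enc ` (grade k :: 'l alg set)) (int n) i"
  shows "CARD('l) ^ n \<le> 2 ^ i"
proof (rule rank_lower_bound[where pure = "\<lambda>I. (I, [])", OF _ _ _ _ _ _ _ _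
      assms[unfolded right_component_iso_def base_ring_enc]])
  fix s v :: "'l alg" assume s: "s \<in> grade 0" and "v \<in> grade (int n)"
  then have "v * s \<in> grade (int n)" using grade_times by fastforce
  then show "\<exists>t\<in>grade (int n). enc s \<odot>\<^bsub>right_component (enc_ring (UNIV :: 'l alg set)) (\<lambda>k. enc ` (grade k :: 'l alg set)) (int n)\<^esub> enc v = enc t
      \<and> (\<forall>I. (I, []) \<in> supp t \<longleftrightarrow> unit_coeff s \<and> (I, []) \<in> supp v)"
    using pure_x_coeff_times[OF s] by (auto simp: right_component_simps)
qed (auto simp: right_component_simps right_power_simps deg_def inj_def fun_eq_iff)

lemma left_component_rank:
  assumes "left_component_iso (enc_ring (UNIV :: 'l::finite alg set)) (\<lambda>k. enc ` (grade k :: 'l alg set)) (- int n) i"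
  shows "CARD('l) ^ n \<le> 2 ^ i"
proof (rule rank_lower_bound[where pure = "\<lambda>J. ([], J)", OF _ _ _ _ _ _ _ _
      assms[unfolded left_component_iso_def base_ring_enc]])
  fix s v :: "'l alg" assume s: "s \<in> grade 0" and "v \<in> grade (- int n)"
  then have "s * v \<in> grade (- int n)" using grade_times by fastforce
  then show "\<exists>t\<in>grade (- int n). enc s \<odot>\<^bsub>left_component (enc_ring (UNIV :: 'l alg set)) (\<lambda>k. enc ` (grade k :: 'l alg set)) (- int n)\<^esub> enc v = enc t
      \<and> (\<forall>J. ([], J) \<in> supp t \<longleftrightarrow> unit_coeff s \<and> ([], J) \<in> supp v)"
    using pure_y_coeff_times[OF s] by (auto simp: left_component_simps)
qed (auto simp: left_component_simps left_power_simps deg_def inj_def fun_eq_iff)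

text \<open>
  A bound \<open>r\<close> on the ranks would apply in degree \<open>r\<close> on the right or in degree \<open>-r\<close> on the left,
  giving \<open>3\<^sup>r \<le> 2\<^sup>r\<close> in the case of three letters.
\<close>

lemma not_boundedly_free:
  assumes "CARD('l::finite) > 2"
  shows "\<not> boundedly_free_grading (enc_ring (UNIV :: 'l alg set)) (\<lambda>k. enc ` (grade k :: 'l alg set))"
proof
  assume "boundedly_free_grading (enc_ring (UNIV :: 'l alg set)) (\<lambda>k. enc ` (grade k :: 'l alg set))"
  then obtain r i where "r > 0" "i \<le> r" "CARD('l) ^ r \<le> 2 ^ i"
    unfolding boundedly_free_grading_def
    using right_component_rank[where 'l = 'l] left_component_rank[where 'l = 'l]
    by (metis atLeastAtMost_iff)
  moreover have "(2::nat) ^ i \<le> 2 ^ r" using \<open>i \<le> r\<close> by (simp add: power_increasing)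
  moreover have "2 ^ r < CARD('l) ^ r" using assms \<open>r > 0\<close> by (simp add: power_strict_mono)
  ultimately show False by linarith
qed

section \<open>The example with three letters\<close>

theorem theorem4p1:
  shows "\<exists>(R :: (nat \<Rightarrow> nat) ring) (G :: int \<Rightarrow> (nat \<Rightarrow> nat) set).
    Z_graded_ring R G \<and> full_grading R G \<and> unboundedly_free_grading R G \<and>
    UGN (base_ring R G) \<and> BGN R"
proof (intro exI conjI)
  let ?R = "enc_ring (UNIV :: 3 alg set)" and ?G = "\<lambda>k. enc ` (grade k :: 3 alg set)"
  show "Z_graded_ring ?R ?G" by (rule enc_Z_graded_ring)
  show "full_grading ?R ?G" by (rule enc_full_grading)
  show "unboundedly_free_grading ?R ?G"
    unfolding unboundedly_free_grading_def free_grading_def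
    using right_component_iso_enc[where 'l = 3] not_boundedly_free[where 'l = 3] by auto
  show "UGN (base_ring ?R ?G)" unfolding base_ring_enc by (rule UGN_base)
  show "BGN ?R" by (rule BGN_total) simp
qed

end
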